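(* For every integer $t\ge 2$, \[ \pi_{\rm link}(t)\le 1-\frac1t-\frac{1}{12t^2}. \]
   Context: A $3$-graph $\mathcal H$ is a collection of $3$-element subsets (edges) of a finite vertex set $V(\mathcal H)$; $|\mathcal H|$ denotes its number of edges. For $v\in V(\mathcal H)$, the link graph of $v$ is the graph $L_{\mathcal H}(v)=\{xy\in\binom{V(\mathcal H)\setminus\{v\}}{2}: vxy\in\mathcal H\}$. Define \[ \operatorname{ex}_{\rm link}(n,t):=\max\{|\mathcal H|: |V(\mathcal H)|=n,\ \chi(L_{\mathcal H}(v))\le t\text{ for every }v\in V(\mathcal H)\}, \] where $\chi$ denotes chromatic number, and $\pi_{\rm link}(t):=\lim_{n\to\infty}\operatorname{ex}_{\rm link}(n,t)/\binom n3$ (this limit exists). *)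

theory Defs
  imports Complex_Main "HOL-Library.Ramsey"
begin

definition three_graph :: "'a set \<Rightarrow> 'a set set \<Rightarrow> bool" where
  "three_graph V H \<longleftrightarrow> finite V \<and> H \<subseteq> nsets V 3"

text \<open>The link graph of \<open>v\<close> has vertex set \<open>V - {v}\<close>; this is its edge set.\<close>

definition link_graph :: "'a set \<Rightarrow> 'a set set \<Rightarrow> 'a \<Rightarrow> 'a set set" where
  "link_graph V H v = {e \<in> nsets (V - {v}) 2. insert v e \<in> H}"

definition proper_colouring :: "'a set \<Rightarrow> 'a set set \<Rightarrow> nat \<Rightarrow> ('a \<Rightarrow> nat) \<Rightarrow> bool" where
  "proper_colouring V E k c \<longleftrightarrow>
     (\<forall>x\<in>V. c x < k) \<and> (\<forall>x\<in>V. \<forall>y\<in>V. {x, y} \<in> E \<longrightarrow> c x \<noteq> c y)"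

definition chromatic_number :: "'a set \<Rightarrow> 'a set set \<Rightarrow> nat" where
  "chromatic_number V E = (LEAST k. \<exists>c. proper_colouring V E k c)"

text \<open>Vertices are taken from \<open>nat\<close>, which loses nothing since vertex sets are finite.
  The set of edge counts is finite and, for \<open>t \<ge> 1\<close>, nonempty (see below), so that \<open>Max\<close>
  is a genuine maximum.\<close>

definition link_sizes :: "nat \<Rightarrow> nat \<Rightarrow> nat set" where
  "link_sizes n t = {card H | (V :: nat set) H. three_graph V H \<and> card V = n \<and>
     (\<forall>v\<in>V. chromatic_number (V - {v}) (link_graph V H v) \<le> t)}"

definition ex_link :: "nat \<Rightarrow> nat \<Rightarrow> nat" where
  "ex_link n t = Max (link_sizes n t)"

definition pi_link :: "nat \<Rightarrow> real" where
  "pi_link t = lim (\<lambda>n. real (ex_link n t) / real (n choose 3))"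

lemma chromatic_number_le_iff:
  assumes "finite V" and "E \<subseteq> nsets V 2"
  shows "chromatic_number V E \<le> k \<longleftrightarrow> (\<exists>c. proper_colouring V E k c)"
proof
  assume le: "chromatic_number V E \<le> k"
  obtain f :: "'a \<Rightarrow> nat" where f: "inj_on f V" "f ` V = {0..<card V}"
    using ex_bij_betw_finite_nat[OF assms(1)] by (auto simp: bij_betw_def)
  have "proper_colouring V E (card V) f"
    unfolding proper_colouring_def
  proof (intro conjI ballI impI)
    show "f x < card V" if "x \<in> V" for x
      using f(2) that by (metis atLeastLessThan_iff imageI)
    show "f x \<noteq> f y" if "x \<in> V" "y \<in> V" "{x, y} \<in> E" for x y
    proof
      assume "f x = f y"
      then have "x = y" using f(1) that by (auto dest: inj_onD)
      then show False using that assms(2) by (auto simp: nsets_def)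
    qed
  qed
  then have "\<exists>k c. proper_colouring V E k c" by blast
  then have "\<exists>c. proper_colouring V E (chromatic_number V E) c"
    unfolding chromatic_number_def by (rule LeastI_ex)
  then show "\<exists>c. proper_colouring V E k c"
    using le unfolding proper_colouring_def by (meson order_less_le_trans)
next
  assume "\<exists>c. proper_colouring V E k c"
  then show "chromatic_number V E \<le> k"
    unfolding chromatic_number_def by (rule Least_le)
qed

lemma link_graph_subset: "link_graph V H v \<subseteq> nsets (V - {v}) 2"
  by (auto simp: link_graph_def)

lemma card_three_graph_le:
  assumes "three_graph V H"
  shows "finite H" and "card H \<le> card V choose 3"
proof -
  have V: "finite V" "H \<subseteq> nsets V 3" using assms by (auto simp: three_graph_def)
  have fin: "finite (nsets V 3)" using V(1) by (simp add: finite_imp_finite_nsets)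
  show "finite H" using V(2) fin by (rule finite_subset)
  show "card H \<le> card V choose 3"
    using card_mono[OF fin V(2)] by (simp add: card_nsets)
qed

lemma finite_link_sizes: "finite (link_sizes n t)"
proof (rule finite_subset)
  show "link_sizes n t \<subseteq> {..n choose 3}"
    using card_three_graph_le(2) by (auto simp: link_sizes_def)
qed simp

lemma link_sizes_nonempty:
  assumes "t \<ge> 1"
  shows "link_sizes n t \<noteq> {}"
proof -
  have "chromatic_number ({..<n} - {v}) (link_graph {..<n} {} v) \<le> t" for v
    using assms link_graph_subset[of "{..<n}" "{}" v]
    by (subst chromatic_number_le_iff)
       (auto simp: proper_colouring_def link_graph_def intro!: exI[of _ "\<lambda>_. 0"])
  then have "card ({} :: nat set set) \<in> link_sizes n t"
    unfolding link_sizes_def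
    by (intro CollectI exI[of _ "{..<n}"] exI[of _ "{}"]) (auto simp: three_graph_def)
  then show ?thesis by blast
qed

lemma ex_link_step:
  assumes "t \<ge> 1"
  shows "(Suc n - 3) * ex_link (Suc n) t \<le> Suc n * ex_link n t"
proof -
  have "ex_link (Suc n) t \<in> link_sizes (Suc n) t"
    unfolding ex_link_def using finite_link_sizes link_sizes_nonempty[OF assms] by (rule Max_in)
  then obtain V :: "nat set" and H where H: "three_graph V H" "card V = Suc n"
      "ex_link (Suc n) t = card H"
      and chi: "\<And>v. v \<in> V \<Longrightarrow> chromatic_number (V - {v}) (link_graph V H v) \<le> t"
    by (auto simp: link_sizes_def)
  have V: "finite V" "H \<subseteq> nsets V 3" using H by (auto simp: three_graph_def)
  have finH: "finite H" using card_three_graph_le(1)[OF H(1)] .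
  have del: "card {e \<in> H. v \<notin> e} \<le> ex_link n t" if v: "v \<in> V" for v
  proof -
    let ?V = "V - {v}" and ?H = "{e \<in> H. v \<notin> e}"
    have "chromatic_number (?V - {u}) (link_graph ?V ?H u) \<le> t" if u: "u \<in> ?V" for u
    proof -
      have "chromatic_number (V - {u}) (link_graph V H u) \<le> t" using chi u by blast
      then obtain c where "proper_colouring (V - {u}) (link_graph V H u) t c"
        using V(1) chromatic_number_le_iff[OF _ link_graph_subset] by (meson finite_Diff)
      moreover have "link_graph ?V ?H u \<subseteq> link_graph V H u"
        by (auto simp: link_graph_def nsets_def)
      ultimately have "proper_colouring (?V - {u}) (link_graph ?V ?H u) t c"
        unfolding proper_colouring_def by blast
      then show ?thesis
        using V(1) chromatic_number_le_iff[OF _ link_graph_subset] by (meson finite_Diff)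
    qed
    moreover have "three_graph ?V ?H" using V by (auto simp: three_graph_def nsets_def)
    moreover have "card ?V = n" using H(2) v V(1) by simp
    ultimately have "card ?H \<in> link_sizes n t" unfolding link_sizes_def by blast
    then show ?thesis unfolding ex_link_def using finite_link_sizes by (intro Max_ge)
  qed
  have "(Suc n - 3) * card H = (\<Sum>e\<in>H. card {v \<in> V. v \<notin> e})"
  proof -
    have "card {v \<in> V. v \<notin> e} = Suc n - 3" if "e \<in> H" for e
    proof -
      have e: "e \<subseteq> V" "finite e" "card e = 3" using that V(2) by (auto simp: nsets_def)
      have "{v \<in> V. v \<notin> e} = V - e" by blast
      then show ?thesis using e H(2) by (simp add: card_Diff_subset)
    qed
    then show ?thesis by simp
  qed
  also have "\<dots> = (\<Sum>v\<in>V. card {e \<in> H. v \<notin> e})"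
    using finH V(1) by (intro sum_multicount_gen) auto
  also have "\<dots> \<le> (\<Sum>v\<in>V. ex_link n t)" by (intro sum_mono del)
  finally show ?thesis using H(2,3) by simp
qed

lemma pi_link_limit_exists:
  assumes "t \<ge> 1"
  shows "convergent (\<lambda>n. real (ex_link n t) / real (n choose 3))"
proof -
  define f where "f n = real (ex_link n t) / real (n choose 3)" for n
  have "f (Suc m + 3) \<le> f (m + 3)" for m
  proof -
    have pos: "(m + 3 choose 3) > 0" "(m + 4 choose 3) > 0" by simp_all
    have abs: "(m + 1) * (m + 4 choose 3) = (m + 4) * (m + 3 choose 3)"
      using binomial_absorb_comp[of "m + 4" 3] by (simp add: eval_nat_numeral)
    have step: "(m + 1) * ex_link (m + 4) t \<le> (m + 4) * ex_link (m + 3) t"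
      using ex_link_step[OF assms, of "m + 3"] by (simp add: eval_nat_numeral)
    have "(m + 1) * (ex_link (m + 4) t * (m + 3 choose 3))
        \<le> (m + 4) * ex_link (m + 3) t * (m + 3 choose 3)"
      using mult_right_mono[OF step, of "m + 3 choose 3"] by (simp only: mult.assoc)
    also have "\<dots> = (m + 1) * (ex_link (m + 3) t * (m + 4 choose 3))"
      using arg_cong[OF abs, of "\<lambda>x. ex_link (m + 3) t * x"] by (simp only: ac_simps)
    finally have "ex_link (m + 4) t * (m + 3 choose 3) \<le> ex_link (m + 3) t * (m + 4 choose 3)"
      by (simp only: mult_le_cancel1)
    then have "real (ex_link (m + 4) t) * real (m + 3 choose 3)
        \<le> real (ex_link (m + 3) t) * real (m + 4 choose 3)"
      by (metis of_nat_le_iff of_nat_mult)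
    then have "f (m + 4) \<le> f (m + 3)"
      unfolding f_def using pos by (simp add: divide_le_eq le_divide_eq mult.commute)
    then show ?thesis by (simp add: eval_nat_numeral)
  qed
  then have "decseq (\<lambda>m. f (m + 3))" by (intro decseq_SucI)
  moreover have "0 \<le> f (m + 3)" for m by (simp add: f_def)
  ultimately obtain L where "(\<lambda>m. f (m + 3)) \<longlonglongrightarrow> L"
    using decseq_convergent by blast
  then have "f \<longlonglongrightarrow> L" by (rule LIMSEQ_offset)
  then have "convergent f" by (rule convergentI)
  then show ?thesis by (simp add: f_def[abs_def])
qed

end

theory Submission
  imports Defs
begin

text \<open>
  Fix for every vertex \<open>v\<close> a \<open>t\<close>-colouring of its link and write \<open>x \<sim>\<^sub>v y\<close> if \<open>v\<close> gives \<open>x\<close> and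
  \<open>y\<close> the same colour; then \<open>vxy\<close> is no edge. Counting these non-edges \<open>vxy\<close> for each \<open>v\<close> gives
  the density bound \<open>1 - 1/t\<close>, and the ordered triples with \<open>x \<sim>\<^sub>v y\<close> but not \<open>v \<sim>\<^sub>x y\<close> improve it.
  There are many of these: if \<open>x \<sim>\<^sub>v y\<close>, \<open>x \<sim>\<^sub>w y\<close> and not \<open>w \<sim>\<^sub>v x\<close>, then by transitivity of \<open>\<sim>\<^sub>x\<close>
  one of the triples \<open>wxy\<close>, \<open>vxy\<close>, \<open>xvw\<close> is such an asymmetric triple, and since \<open>w\<close> splits every
  colour class \<open>C\<close> of \<open>v\<close> into at most \<open>t\<close> parts, such \<open>x, y \<in> C\<close> make up a proportion of at least
  \<open>1/t\<close> of all pairs in \<open>C\<close>.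
\<close>

section \<open>Convexity estimates for colour class sizes\<close>

lemma sum_monochromatic_pairs:
  fixes g :: "'a \<Rightarrow> 'a \<Rightarrow> real"
  assumes "finite A" "\<forall>x\<in>A. c x < (t::nat)"
  shows "(\<Sum>x\<in>A. \<Sum>y\<in>A. of_bool (c x = c y) * g x y)
       = (\<Sum>i<t. \<Sum>x\<in>{x\<in>A. c x = i}. \<Sum>y\<in>{y\<in>A. c y = i}. g x y)"
proof -
  have "(\<Sum>x\<in>A. \<Sum>y\<in>A. of_bool (c x = c y) * g x y)
      = (\<Sum>x\<in>A. \<Sum>y\<in>{y\<in>A. c y = c x}. g x y)"
    using assms(1) by (intro sum.cong refl sum.mono_neutral_cong_right) auto
  also have "\<dots> = (\<Sum>i<t. \<Sum>x\<in>{x\<in>A. c x = i}. \<Sum>y\<in>{y\<in>A. c y = c x}. g x y)"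
    using assms by (intro sum.group[symmetric]) auto
  also have "\<dots> = (\<Sum>i<t. \<Sum>x\<in>{x\<in>A. c x = i}. \<Sum>y\<in>{y\<in>A. c y = i}. g x y)"
    by (intro sum.cong refl) auto
  finally show ?thesis .
qed

lemma sum_card_colour_classes:
  assumes "finite A" "\<forall>x\<in>A. c x < (t::nat)"
  shows "(\<Sum>i<t. real (card {x\<in>A. c x = i})) = real (card A)"
proof -
  have "(\<Sum>i<t. \<Sum>x\<in>{x\<in>A. c x = i}. (1::real)) = (\<Sum>x\<in>A. 1)"
    using assms by (intro sum.group) auto
  then show ?thesis by simp
qed

text \<open>By convexity of the square, equal classes minimise the number of ordered pairs, diagonal
  pairs included.\<close>

lemma monochromatic_pairs_ge:
  assumes "finite A" "\<forall>x\<in>A. c x < (t::nat)" "t \<ge> 1"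
  shows "(real (card A))\<^sup>2 / real t \<le> (\<Sum>x\<in>A. \<Sum>y\<in>A. of_bool (c x = c y))"
proof -
  define k where "k i = real (card {x\<in>A. c x = i})" for i
  define m where "m = real (card A) / real t"
  have eq: "(\<Sum>x\<in>A. \<Sum>y\<in>A. of_bool (c x = c y)) = (\<Sum>i<t. (k i)\<^sup>2)"
    using sum_monochromatic_pairs[OF assms(1,2), of "\<lambda>_ _. 1"] by (simp add: k_def power2_eq_square)
  \<comment> \<open>Each square lies above its tangent at the mean \<open>m\<close>; the tangents
    sum to a value independent of the class sizes.\<close>
  have "(\<Sum>i<t. 2 * m * k i - m\<^sup>2) \<le> (\<Sum>i<t. (k i)\<^sup>2)"
  proof (rule sum_mono)
    show "2 * m * k i - m\<^sup>2 \<le> (k i)\<^sup>2" for i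
      using sum_squares_bound[of m "k i"] by simp
  qed
  moreover have "(\<Sum>i<t. 2 * m * k i - m\<^sup>2) = 2 * m * real (card A) - real t * m\<^sup>2"
    using sum_card_colour_classes[OF assms(1,2)]
    by (simp add: sum_subtractf k_def flip: sum_distrib_left)
  moreover have "2 * m * real (card A) - real t * m\<^sup>2 = (real (card A))\<^sup>2 / real t"
    using assms(3) by (simp add: m_def field_simps power2_eq_square)
  ultimately show ?thesis using eq by simp
qed

text \<open>The right-hand side is the tangent of the left-hand side (convex in \<open>u\<close>) at \<open>u = s\<close>.\<close>

lemma class_density_tangent:
  fixes u s :: real
  assumes "0 \<le> s" "s \<le> 1 / 2" "0 \<le> u" "u \<le> 1"
  shows "u\<^sup>2 + u\<^sup>2 * (1 - u) * s / 3 \<ge> s\<^sup>2 + s ^ 3 * (1 - s) / 3 + (u - s) * (2 * s * (1 + s / 3) - s ^ 3)"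
proof -
  \<comment> \<open>The difference of the two sides is \<open>(u - s)^2\<close> times a factor
    linear in \<open>u\<close>; \<open>2 * s + u \<le> 2\<close> keeps that factor positive.\<close>
  have "s / 3 * (2 * s + u) \<le> s / 3 * 2" using assms by (intro mult_left_mono) auto
  then have "0 \<le> (u - s)\<^sup>2 * (1 + s / 3 - s / 3 * (2 * s + u))"
    using assms by (intro mult_nonneg_nonneg) auto
  also have "\<dots> = u\<^sup>2 + u\<^sup>2 * (1 - u) * s / 3
      - (s\<^sup>2 + s ^ 3 * (1 - s) / 3 + (u - s) * (2 * s * (1 + s / 3) - s ^ 3))"
    by (simp add: field_simps power2_eq_square power3_eq_cube)
  finally show ?thesis by simp
qed

text \<open>The \<open>u i\<close> are proportions of colour classes. Summing the tangents at
  \<open>s = 1 / t\<close> cancels the linear terms, so equal classes are the worst case.\<close>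

lemma class_densities_ge:
  fixes u :: "nat \<Rightarrow> real"
  assumes "t \<ge> 2" "\<And>i. i < t \<Longrightarrow> 0 \<le> u i \<and> u i \<le> 1" "(\<Sum>i<t. u i) = 1"
  shows "(\<Sum>i<t. (u i)\<^sup>2) + (\<Sum>i<t. (u i)\<^sup>2 * (1 - u i)) / (3 * real t)
     \<ge> 1 / real t + 1 / (12 * (real t)\<^sup>2)"
proof -
  define s where "s = 1 / real t"
  have s: "0 \<le> s" "s \<le> 1 / 2" "real t * s = 1" using assms(1) by (auto simp: s_def field_simps)
  define D where "D = 2 * s * (1 + s / 3) - s ^ 3"
  have "1 / real t + 1 / (12 * (real t)\<^sup>2) = s + s\<^sup>2 * (1 / 12)"
    by (simp add: s_def power_divide)
  \<comment> \<open>Here \<open>1 - s \<ge> 1 / 2\<close> would give even 1/6 in place of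
    1/12.\<close>
  also have "\<dots> \<le> s + s\<^sup>2 * ((1 - s) / 3)"
    using s by (intro add_left_mono mult_left_mono) auto
  also have "\<dots> = (real t * s) * (s + s\<^sup>2 * ((1 - s) / 3))" using s(3) by simp
  also have "\<dots> = real t * (s\<^sup>2 + s ^ 3 * (1 - s) / 3)"
    by (simp add: algebra_simps power2_eq_square power3_eq_cube)
  also have "\<dots> = (\<Sum>i<t. s\<^sup>2 + s ^ 3 * (1 - s) / 3 + (u i - s) * D)"
    using s(3) assms(3) by (simp add: sum.distrib sum_subtractf flip: sum_distrib_right)
  also have "\<dots> \<le> (\<Sum>i<t. (u i)\<^sup>2 + (u i)\<^sup>2 * (1 - u i) * s / 3)"
    unfolding D_def using assms(2) s by (intro sum_mono class_density_tangent) auto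
  also have "\<dots> = (\<Sum>i<t. (u i)\<^sup>2) + (\<Sum>i<t. (u i)\<^sup>2 * (1 - u i)) / (3 * real t)"
    by (simp add: sum.distrib sum_divide_distrib s_def mult.commute)
  finally show ?thesis .
qed

text \<open>Rescaled to class sizes: the first sum counts the pairs that one vertex colours alike,
  the second is its share in the lower bound for asymmetric triples.\<close>

lemma class_sizes_ge:
  fixes k :: "nat \<Rightarrow> real"
  assumes "t \<ge> 2" "n > 0" "\<And>i. i < t \<Longrightarrow> 0 \<le> k i \<and> k i \<le> n" "(\<Sum>i<t. k i) = n"
  shows "(\<Sum>i<t. (k i)\<^sup>2) + (\<Sum>i<t. (k i)\<^sup>2 * (n - k i)) / (3 * n * real t)
     \<ge> n\<^sup>2 * (1 / real t + 1 / (12 * (real t)\<^sup>2))"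
proof -
  define u where "u i = k i / n" for i
  have k: "k i = n * u i" for i using assms(2) by (simp add: u_def)
  have "(\<Sum>i<t. u i) = 1"
    using assms(2,4) by (simp add: u_def flip: sum_divide_distrib)
  then have "n\<^sup>2 * (1 / real t + 1 / (12 * (real t)\<^sup>2))
      \<le> n\<^sup>2 * ((\<Sum>i<t. (u i)\<^sup>2) + (\<Sum>i<t. (u i)\<^sup>2 * (1 - u i)) / (3 * real t))"
    using assms(1-3) by (intro mult_left_mono class_densities_ge) (auto simp: u_def)
  also have "\<dots> = (\<Sum>i<t. (k i)\<^sup>2) + n ^ 3 * (\<Sum>i<t. (u i)\<^sup>2 * (1 - u i)) / (3 * n * real t)"
    using assms(2)
    by (simp add: k power_mult_distrib distrib_left power3_eq_cube power2_eq_square[of n] mult.assoc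
        flip: sum_distrib_left)
  also have "n ^ 3 * (\<Sum>i<t. (u i)\<^sup>2 * (1 - u i)) = (\<Sum>i<t. (k i)\<^sup>2 * (n - k i))"
    by (simp add: k sum_distrib_left algebra_simps power2_eq_square power3_eq_cube)
  finally show ?thesis .
qed

section \<open>Crossing quadruples and asymmetric triples\<close>

text \<open>Each of the \<open>card V - card C\<close> vertices \<open>w\<close> outside a class
  \<open>C\<close> of \<open>v\<close> colours \<open>C\<close> with \<open>t\<close> colours, so at
  least \<open>(card C)^2 / t\<close> ordered pairs in \<open>C\<close> are monochromatic for
  \<open>w\<close> too.\<close>

lemma crossing_quadruples_ge:
  fixes c :: "'a \<Rightarrow> 'a \<Rightarrow> nat"
  assumes "finite V" "\<forall>v\<in>V. \<forall>x\<in>V. c v x < t" "t \<ge> 1" "v \<in> V"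
  shows "(\<Sum>i<t. (real (card {x\<in>V. c v x = i}))\<^sup>2 * (real (card V) - real (card {x\<in>V. c v x = i}))) / real t
     \<le> (\<Sum>w\<in>V. \<Sum>x\<in>V. \<Sum>y\<in>V. of_bool (c v x = c v y \<and> c w x = c w y \<and> c v w \<noteq> c v x))"
proof -
  define C where "C i = {x\<in>V. c v x = i}" for i
  have fin: "finite (C i)" for i using assms(1) by (simp add: C_def)
  have "(\<Sum>i<t. (real (card (C i)))\<^sup>2 * (real (card V) - real (card (C i)))) / real t
      = (\<Sum>i<t. \<Sum>w\<in>V. of_bool (c v w \<noteq> i) * ((real (card (C i)))\<^sup>2 / real t))"
  proof -
    have "(\<Sum>w\<in>V. of_bool (c v w \<noteq> i)) = real (card V) - real (card (C i))" for i
    proof -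
      have "(\<Sum>w\<in>V. of_bool (c v w \<noteq> i)) = (\<Sum>w\<in>V. 1 - of_bool (c v w = i) :: real)"
        by (intro sum.cong) auto
      also have "\<dots> = real (card V) - real (card (C i))"
        using assms(1) by (simp add: sum_subtractf C_def Int_def)
      finally show ?thesis .
    qed
    then show ?thesis
      by (simp only: sum_distrib_right[symmetric]) (simp add: sum_divide_distrib mult.commute)
  qed
  also have "\<dots> \<le> (\<Sum>i<t. \<Sum>w\<in>V. of_bool (c v w \<noteq> i) * (\<Sum>x\<in>C i. \<Sum>y\<in>C i. of_bool (c w x = c w y)))"
    using assms fin
    by (intro sum_mono mult_left_mono monochromatic_pairs_ge) (auto simp: C_def)
  also have "\<dots> = (\<Sum>w\<in>V. \<Sum>i<t. \<Sum>x\<in>C i. \<Sum>y\<in>C i. of_bool (c w x = c w y \<and> c v w \<noteq> c v x))"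
    by (subst sum.swap, intro sum.cong refl)
       (auto simp: sum_distrib_left C_def intro!: sum.cong)
  also have "\<dots> = (\<Sum>w\<in>V. \<Sum>x\<in>V. \<Sum>y\<in>V. of_bool (c v x = c v y) * of_bool (c w x = c w y \<and> c v w \<noteq> c v x))"
    unfolding C_def using assms by (intro sum.cong refl sum_monochromatic_pairs[symmetric]) auto
  finally show ?thesis by (simp add: C_def flip: of_bool_conj)
qed

text \<open>Every quadruple yields one of three asymmetric triples, each of which leaves one vertex
  of the quadruple free; hence the factor \<open>3 * card V\<close>.\<close>

lemma crossing_quadruples_le:
  fixes c :: "'a \<Rightarrow> 'a \<Rightarrow> nat" and V :: "'a set"
  defines "D \<equiv> (\<Sum>a\<in>V. \<Sum>x\<in>V. \<Sum>y\<in>V. of_bool (c a x = c a y \<and> c x a \<noteq> c x y) :: real)"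
  shows "(\<Sum>v\<in>V. \<Sum>w\<in>V. \<Sum>x\<in>V. \<Sum>y\<in>V. of_bool (c v x = c v y \<and> c w x = c w y \<and> c v w \<noteq> c v x))
     \<le> 3 * real (card V) * D"
proof -
  define f :: "'a \<Rightarrow> 'a \<Rightarrow> 'a \<Rightarrow> real" where "f a x y = of_bool (c a x = c a y \<and> c x a \<noteq> c x y)" for a x y
  have D: "D = (\<Sum>a\<in>V. \<Sum>x\<in>V. \<Sum>y\<in>V. f a x y)" by (simp add: D_def f_def)
  have "(\<Sum>v\<in>V. \<Sum>w\<in>V. \<Sum>x\<in>V. \<Sum>y\<in>V. of_bool (c v x = c v y \<and> c w x = c w y \<and> c v w \<noteq> c v x))
     \<le> (\<Sum>v\<in>V. \<Sum>w\<in>V. \<Sum>x\<in>V. \<Sum>y\<in>V. f w x y + f v x y + f x v w)"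
    \<comment> \<open>If \<open>f w x y\<close> and \<open>f v x y\<close> vanish, then
      \<open>c x w = c x y = c x v\<close>, and \<open>c v w \<noteq> c v x\<close> makes
      \<open>f x v w\<close> equal to 1.\<close>
    by (intro sum_mono) (auto simp: f_def)
  also have "\<dots> = (\<Sum>v\<in>V. \<Sum>w\<in>V. \<Sum>x\<in>V. \<Sum>y\<in>V. f w x y) + (\<Sum>v\<in>V. \<Sum>w\<in>V. \<Sum>x\<in>V. \<Sum>y\<in>V. f v x y)
      + (\<Sum>v\<in>V. \<Sum>w\<in>V. \<Sum>x\<in>V. \<Sum>y\<in>V. f x v w)"
    by (simp add: sum.distrib)
  also have "(\<Sum>v\<in>V. \<Sum>w\<in>V. \<Sum>x\<in>V. \<Sum>y\<in>V. f w x y) = real (card V) * D"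
    by (simp add: D)
  also have "(\<Sum>v\<in>V. \<Sum>w\<in>V. \<Sum>x\<in>V. \<Sum>y\<in>V. f v x y) = real (card V) * D"
    by (simp add: D sum_distrib_left)
  also have "(\<Sum>v\<in>V. \<Sum>w\<in>V. \<Sum>x\<in>V. \<Sum>y\<in>V. f x v w) = real (card V) * D"
  proof -
    have "(\<Sum>v\<in>V. \<Sum>w\<in>V. \<Sum>x\<in>V. f x v w) = (\<Sum>v\<in>V. \<Sum>x\<in>V. \<Sum>w\<in>V. f x v w)"
      by (intro sum.cong refl sum.swap)
    also have "\<dots> = D" unfolding D by (rule sum.swap)
    finally show ?thesis by (simp flip: sum_distrib_left)
  qed
  finally show ?thesis by (simp add: mult_ac)
qed

text \<open>Triples witnessed by \<open>a\<close> contribute the squared class sizes; those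
  witnessed by \<open>x\<close> but not by \<open>a\<close> are asymmetric, and the two crossing
  bounds force many of them.\<close>

lemma nonedge_triples_ge:
  fixes c :: "'a \<Rightarrow> 'a \<Rightarrow> nat"
  assumes "finite V" "\<forall>v\<in>V. \<forall>x\<in>V. c v x < t" "t \<ge> 2"
  shows "(\<Sum>a\<in>V. \<Sum>x\<in>V. \<Sum>y\<in>V. of_bool (c a x = c a y \<or> c x a = c x y))
     \<ge> (real (card V))^3 * (1 / real t + 1 / (12 * (real t)\<^sup>2))"
proof (cases "V = {}")
  case False
  define n where "n = real (card V)"
  have n: "n > 0" using False assms(1) by (simp add: n_def card_gt_0_iff)
  define k where "k v i = real (card {x\<in>V. c v x = i})" for v i
  define D where "D = (\<Sum>a\<in>V. \<Sum>x\<in>V. \<Sum>y\<in>V. of_bool (c a x = c a y \<and> c x a \<noteq> c x y) :: real)"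
  define S where "S = (\<Sum>v\<in>V. \<Sum>i<t. (k v i)\<^sup>2 * (n - k v i))"
  have "S / real t \<le> (\<Sum>v\<in>V. \<Sum>w\<in>V. \<Sum>x\<in>V. \<Sum>y\<in>V. of_bool (c v x = c v y \<and> c w x = c w y \<and> c v w \<noteq> c v x))"
    unfolding S_def k_def n_def sum_divide_distrib
    using crossing_quadruples_ge[OF assms(1,2)] assms(3) by (intro sum_mono) (simp add: sum_divide_distrib)
  also have "\<dots> \<le> 3 * n * D" unfolding n_def D_def by (rule crossing_quadruples_le)
  finally have SD: "S / (3 * n * real t) \<le> D" using n assms(3) by (simp add: field_simps)
  have "n^3 * (1 / real t + 1 / (12 * (real t)\<^sup>2))
      = (\<Sum>v\<in>V. n\<^sup>2 * (1 / real t + 1 / (12 * (real t)\<^sup>2)))"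
    by (simp add: n_def power2_eq_square power3_eq_cube)
  also have "\<dots> \<le> (\<Sum>v\<in>V. (\<Sum>i<t. (k v i)\<^sup>2) + (\<Sum>i<t. (k v i)\<^sup>2 * (n - k v i)) / (3 * n * real t))"
  proof (intro sum_mono class_sizes_ge assms(3) n)
    fix v assume v: "v \<in> V"
    show "0 \<le> k v i \<and> k v i \<le> n" for i
      using assms(1) by (auto simp: k_def n_def intro!: card_mono)
    show "(\<Sum>i<t. k v i) = n"
      unfolding k_def n_def using v assms by (intro sum_card_colour_classes) auto
  qed
  also have "\<dots> = (\<Sum>v\<in>V. \<Sum>i<t. (k v i)\<^sup>2) + S / (3 * n * real t)"
    by (simp add: S_def sum.distrib sum_divide_distrib)
  also have "\<dots> \<le> (\<Sum>v\<in>V. \<Sum>i<t. (k v i)\<^sup>2) + D" using SD by simp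
  also have "(\<Sum>v\<in>V. \<Sum>i<t. (k v i)\<^sup>2) = (\<Sum>v\<in>V. \<Sum>x\<in>V. \<Sum>y\<in>V. of_bool (c v x = c v y))"
  proof (rule sum.cong)
    fix v assume "v \<in> V"
    then show "(\<Sum>i<t. (k v i)\<^sup>2) = (\<Sum>x\<in>V. \<Sum>y\<in>V. of_bool (c v x = c v y))"
      using sum_monochromatic_pairs[of V "c v" t "\<lambda>_ _. 1"] assms
      by (simp add: k_def power2_eq_square)
  qed simp
  \<comment> \<open>Exchanging \<open>a\<close> and \<open>x\<close> makes the asymmetric triples
    disjoint from those with \<open>c a x = c a y\<close>.\<close>
  also have "D = (\<Sum>a\<in>V. \<Sum>x\<in>V. \<Sum>y\<in>V. of_bool (c x a = c x y \<and> c a x \<noteq> c a y))"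
    unfolding D_def by (rule sum.swap)
  also have "(\<Sum>v\<in>V. \<Sum>x\<in>V. \<Sum>y\<in>V. of_bool (c v x = c v y)) + \<dots>
      = (\<Sum>a\<in>V. \<Sum>x\<in>V. \<Sum>y\<in>V. of_bool (c a x = c a y \<or> c x a = c x y))"
    unfolding sum.distrib[symmetric] by (intro sum.cong refl) auto
  finally show ?thesis by (simp add: n_def)
qed simp

section \<open>From triples to edge counts and the limit density\<close>

lemma six_card_three_graph_le:
  assumes "three_graph V H"
  shows "6 * card H \<le> card {(a, x, y) \<in> V \<times> V \<times> V. {a, x, y} \<in> H}"
proof -
  have V: "finite V" "H \<subseteq> nsets V 3" using assms by (auto simp: three_graph_def)
  have finH: "finite H" using card_three_graph_le(1)[OF assms] .
  define T where "T e = {(a, x, y) \<in> V \<times> V \<times> V. {a, x, y} = e}" for e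
  have finT: "finite (T e)" for e
    using V(1) by (auto simp: T_def intro: finite_subset[of _ "V \<times> V \<times> V"])
  have "6 \<le> card (T e)" if "e \<in> H" for e
  proof -
    have "card e = 3" "e \<subseteq> V" using that V(2) by (auto simp: nsets_def)
    then obtain a b d where e: "e = {a, b, d}" "a \<noteq> b" "b \<noteq> d" "a \<noteq> d"
      by (auto simp: card_3_iff)
    have "card {(a,b,d), (a,d,b), (b,a,d), (b,d,a), (d,a,b), (d,b,a)} \<le> card (T e)"
      using e \<open>e \<subseteq> V\<close> by (intro card_mono finT) (auto simp: T_def)
    then show ?thesis using e by simp
  qed
  then have "(\<Sum>e\<in>H. 6) \<le> (\<Sum>e\<in>H. card (T e))" by (intro sum_mono)
  also have "\<dots> = card (\<Union>e\<in>H. T e)"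
    using finH finT by (intro card_UN_disjoint[symmetric]) (auto simp: T_def)
  also have "(\<Union>e\<in>H. T e) = {(a, x, y) \<in> V \<times> V \<times> V. {a, x, y} \<in> H}"
    by (auto simp: T_def)
  finally show ?thesis by simp
qed

text \<open>Each edge has six orderings, and none of them is among the triples bounded in
  \<open>nonedge_triples_ge\<close>.\<close>

lemma card_link_colourable_le:
  assumes H: "three_graph V H"
    and chi: "\<And>v. v \<in> V \<Longrightarrow> chromatic_number (V - {v}) (link_graph V H v) \<le> t"
    and t: "t \<ge> 2"
  shows "6 * real (card H) \<le> (real (card V))^3 * (1 - 1 / real t - 1 / (12 * (real t)\<^sup>2))"
proof -
  have V: "finite V" "H \<subseteq> nsets V 3" using H by (auto simp: three_graph_def)
  have "\<forall>v\<in>V. \<exists>c. proper_colouring (V - {v}) (link_graph V H v) t c"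
    using chi V(1) chromatic_number_le_iff[OF _ link_graph_subset] by (meson finite_Diff)
  then obtain c0 where c0: "\<And>v. v \<in> V \<Longrightarrow> proper_colouring (V - {v}) (link_graph V H v) t (c0 v)"
    by metis
  \<comment> \<open>The link colouring of \<open>v\<close> is constrained only away from
    \<open>v\<close>; the value 0, below \<open>t\<close>, extends it to \<open>V\<close>, since the
    counts include triples with repeated vertices.\<close>
  define c where "c v x = (if x = v then 0 else c0 v x)" for v x
  have lt: "\<forall>v\<in>V. \<forall>x\<in>V. c v x < t"
    using c0 t by (auto simp: c_def proper_colouring_def)
  have proper: "c a x \<noteq> c a y" if "{a, x, y} \<in> H" for a x y
  proof -
    have "card {a, x, y} = 3" "{a, x, y} \<subseteq> V" using that V(2) by (auto simp: nsets_def)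
    then have d: "a \<noteq> x" "a \<noteq> y" "x \<noteq> y" "a \<in> V" "x \<in> V" "y \<in> V"
      by (auto simp: card_insert_if split: if_splits)
    then have "{x, y} \<in> link_graph V H a" using that by (auto simp: link_graph_def nsets_def)
    then show ?thesis using c0[of a] d by (auto simp: proper_colouring_def c_def)
  qed
  have "6 * real (card H) \<le> real (card {(a, x, y) \<in> V \<times> V \<times> V. {a, x, y} \<in> H})"
    using six_card_three_graph_le[OF H] by linarith
  also have "\<dots> = (\<Sum>a\<in>V. \<Sum>x\<in>V. \<Sum>y\<in>V. of_bool ({a, x, y} \<in> H))"
  proof -
    have "{(a, x, y) \<in> V \<times> V \<times> V. {a, x, y} \<in> H} = (SIGMA a:V. SIGMA x:V. {y\<in>V. {a, x, y} \<in> H})"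
      by auto
    then show ?thesis using V(1) by (simp add: card_SigmaI Int_def)
  qed
  \<comment> \<open>Properness is applied in the links of both \<open>a\<close> and
    \<open>x\<close>, as \<open>{a, x, y} = {x, a, y}\<close>.\<close>
  also have "\<dots> \<le> (\<Sum>a\<in>V. \<Sum>x\<in>V. \<Sum>y\<in>V. 1 - of_bool (c a x = c a y \<or> c x a = c x y))"
    using proper by (intro sum_mono) (auto simp: insert_commute)
  also have "\<dots> = (real (card V))^3 - (\<Sum>a\<in>V. \<Sum>x\<in>V. \<Sum>y\<in>V. of_bool (c a x = c a y \<or> c x a = c x y))"
    by (simp only: sum_subtractf) (simp add: power3_eq_cube)
  also have "\<dots> \<le> (real (card V))^3 - (real (card V))^3 * (1 / real t + 1 / (12 * (real t)\<^sup>2))"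
    using nonedge_triples_ge[OF V(1) lt t] by simp
  finally show ?thesis by (simp add: algebra_simps)
qed

theorem theorem1p2:
  fixes t :: nat
  assumes "t \<ge> 2"
  shows "pi_link t \<le> 1 - 1 / real t - 1 / (12 * (real t)\<^sup>2)"
proof -
  define b where "b = 1 - 1 / real t - 1 / (12 * (real t)\<^sup>2)"
  have t1: "t \<ge> 1" using assms by simp
  have bound: "6 * real (ex_link n t) \<le> (real n)^3 * b" for n
  proof -
    have "ex_link n t \<in> link_sizes n t"
      unfolding ex_link_def using finite_link_sizes link_sizes_nonempty[OF t1] by (rule Max_in)
    then obtain V :: "nat set" and H where "three_graph V H" "card V = n" "ex_link n t = card H"
        "\<And>v. v \<in> V \<Longrightarrow> chromatic_number (V - {v}) (link_graph V H v) \<le> t"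
      by (auto simp: link_sizes_def)
    then show ?thesis using card_link_colourable_le[of V H t] assms by (simp add: b_def)
  qed
  have le: "real (ex_link n t) / real (n choose 3) \<le> b / ((1 - 1 / real n) * (1 - 2 / real n))"
    if "n \<ge> 3" for n
  proof -
    \<comment> \<open>\<open>P\<close> is the ratio of \<open>n choose 3\<close> to
      \<open>n^3 / 6\<close>; it is positive for \<open>n \<ge> 3\<close> and tends to 1.\<close>
    define P where "P = (1 - 1 / real n) * (1 - 2 / real n)"
    have P: "P > 0" using that by (simp add: P_def)
    have "real (n choose 3) = real n * (real n - 1) * (real n - 2) / 6"
      by (simp add: binomial_gbinomial gbinomial_prod_rev numeral_3_eq_3 fact_numeral)
    also have "\<dots> = real n ^ 3 * P / 6"
      using that by (simp add: P_def field_simps power3_eq_cube)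
    finally have "real (ex_link n t) / real (n choose 3) = 6 * real (ex_link n t) / (real n ^ 3 * P)"
      by (simp only:) simp
    also have "\<dots> \<le> real n ^ 3 * b / (real n ^ 3 * P)"
      using bound[of n] P by (intro divide_right_mono) auto
    also have "\<dots> = b / P" using that by simp
    finally show ?thesis by (simp add: P_def)
  qed
  \<comment> \<open>Convergence turns the \<open>lim\<close> in \<open>pi_link\<close> into a
    genuine limit, to which termwise bounds pass.\<close>
  have "(\<lambda>n. real (ex_link n t) / real (n choose 3)) \<longlonglongrightarrow> pi_link t"
    unfolding pi_link_def using pi_link_limit_exists[OF t1] by (simp add: convergent_LIMSEQ_iff)
  moreover have "(\<lambda>n. b / ((1 - 1 / real n) * (1 - 2 / real n))) \<longlonglongrightarrow> b / ((1 - 0) * (1 - 0))"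
    by (intro tendsto_intros lim_const_over_n) auto
  ultimately have "pi_link t \<le> b / ((1 - 0) * (1 - 0))"
    by (rule LIMSEQ_le) (use le in blast)
  then show ?thesis by (simp add: b_def)
qed

end
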